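(* Consider any 1G$n$B system with parameters $n,p_{\mathrm{gen}},p_{\mathrm{con}},q,\Gamma,F_{\mathrm{new}}$ and any policy coefficients $(a_k,b_k,c_k,d_k)_{k=1}^n$. Its availability $A$ is bounded as $$\frac{p^*_{\mathrm{gen}}\,(\gamma+p_{\mathrm{con}})}{\xi+\xi'\,p^*_{\mathrm{gen}}+\xi''\,(p^*_{\mathrm{gen}})^2}\le A\le\frac{p^*_{\mathrm{gen}}}{p^*_{\mathrm{gen}}+p_{\mathrm{con}}},$$ with $p^*_{\mathrm{gen}}=1-(1-p_{\mathrm{gen}})^n$, $\gamma=e^\Gamma-1$, $\xi=\gamma p_{\mathrm{con}}+p_{\mathrm{con}}^2$, $\xi'=1+2\gamma+(2-\gamma)p_{\mathrm{con}}-2p_{\mathrm{con}}^2$ and $\xi''=2(1-p_{\mathrm{con}})^2$. Moreover, the upper bound is tight: for any purification policy it is attained with equality when $q=0$.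
   Context: Model (1G$n$B system). Parameters: an integer $n\ge1$; $p_{\mathrm{gen}}\in(0,1]$; $p_{\mathrm{con}}\in(0,1]$; $q\in[0,1]$; $\Gamma\ge0$; $F_{\mathrm{new}}\in(1/4,1]$; and, for $k=1,\dots,n$, real constants $a_k,b_k,c_k,d_k$ (the purification policy). Put $p_k(F)=c_k(F-\frac14)+d_k$ (success probability) and $J_k(F)=\frac14+\frac{a_k(F-1/4)+b_k}{c_k(F-1/4)+d_k}$ (jump function). Physicality: for all $F\in[1/4,1]$, $0\le p_k(F)\le1$ and $0\le a_k(F-\frac14)+b_k\le\frac34p_k(F)$ (i.e. $J_k(F)\in[1/4,1]$ when $p_k(F)>0$). Dynamics. For $t=1,2,\dots$ let $X_t\sim\mathrm{Bernoulli}(p_{\mathrm{con}})$ (a consumption request arrives at time $t$), $K_t\sim\mathrm{Bin}(n,p_{\mathrm{gen}})$, $Q_t\sim\mathrm{Bernoulli}(q)$, $W_t\sim\mathrm{Unif}[0,1]$, all independent. $F(t)$ is the fidelity of the link in memory G at time $t$ ($F(t)=0$ means G is empty); $F(0)=F_{\mathrm{new}}$. Let $F^-(t)=e^{-\Gamma}(F(t-1)-\frac14)+\frac14$ if $F(t-1)>0$ and $F^-(t)=0$ if $F(t-1)=0$. If $F(t-1)=0$, then $F(t)=F_{\mathrm{new}}$ if $K_t\ge1$ and $F(t)=0$ otherwise. If $F(t-1)>0$: when $X_t=1$, $F(t)=0$ (consumption); when $X_t=0$, $K_t\ge1$, $Q_t=1$, with $k=K_t$, $F(t)=J_k(F^-(t))$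 if $W_t<p_k(F^-(t))$ and $F(t)=0$ otherwise; in all remaining cases $F(t)=F^-(t)$. The availability is $A=\lim_{m\to\infty}\frac1m\sum_{j=1}^m\mathbb 1\{F^-(T^{(j)}_{\mathrm{con}})>0\}$, where $T^{(j)}_{\mathrm{con}}$ is the $j$-th time with $X_t=1$. Convention. $A$ is almost surely equal to a deterministic function of the parameters, and $A$ denotes this function: $$A=\frac{E_{\mathrm{occ}}}{\frac1{p^*_{\mathrm{gen}}}+E_{\mathrm{occ}}},\qquad E_{\mathrm{occ}}=\frac{1-\tilde A+\tilde C(F_{\mathrm{new}}-\frac14)}{[(1-\tilde A)(1-\tilde D)-\tilde B\tilde C]\tilde P},$$ where $p^*_{\mathrm{gen}}=1-(1-p_{\mathrm{gen}})^n$, $\tilde P=p_{\mathrm{con}}+qp^*_{\mathrm{gen}}(1-p_{\mathrm{con}})$, $\tilde A=\frac{q(1-p_{\mathrm{con}})\tilde a}{e^\Gamma-(1-qp^*_{\mathrm{gen}})(1-p_{\mathrm{con}})}$, $\tilde C=\frac{q(1-p_{\mathrm{con}})\tilde c}{e^\Gamma-(1-qp^*_{\mathrm{gen}})(1-p_{\mathrm{con}})}$, $\tilde B=\frac{q(1-p_{\mathrm{con}})\tilde b}{\tilde P}$, $\tilde D=\frac{q(1-p_{\mathrm{con}})\tilde d}{\tilde P}$, and $\tilde a=\sum_{k=1}^na_k\binom nk(1-p_{\mathrm{gen}})^{n-k}p_{\mathrm{gen}}^k$, with $\tilde b,\tilde c,\tilde d$ defined likewise from $b_k,c_k,d_k$.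 *)

theory Defs
  imports Complex_Main
begin

text \<open>
  Policy coefficients are functions \<open>a b c d :: nat \<Rightarrow> real\<close>; only their values on \<open>{1..n}\<close> matter.
  The policy acting on \<open>k\<close> fresh links maps a buffered link of fidelity \<open>F\<close> to fidelity
  \<open>1/4 + purif_num a b k F / purif_prob c d k F\<close>, with success probability \<open>purif_prob c d k F\<close>.
\<close>

definition purif_prob :: "(nat \<Rightarrow> real) \<Rightarrow> (nat \<Rightarrow> real) \<Rightarrow> nat \<Rightarrow> real \<Rightarrow> real" where
  "purif_prob c d k F = c k * (F - 1/4) + d k"

definition purif_num :: "(nat \<Rightarrow> real) \<Rightarrow> (nat \<Rightarrow> real) \<Rightarrow> nat \<Rightarrow> real \<Rightarrow> real" where
  "purif_num a b k F = a k * (F - 1/4) + b k"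

text \<open>
  The bounds on \<open>purif_num\<close> say that the fidelity after a successful purification lies in
  \<open>[1/4, 1]\<close>; in this form they also make sense where the success probability vanishes.
\<close>

definition physical_policy ::
  "nat \<Rightarrow> (nat \<Rightarrow> real) \<Rightarrow> (nat \<Rightarrow> real) \<Rightarrow> (nat \<Rightarrow> real) \<Rightarrow> (nat \<Rightarrow> real) \<Rightarrow> bool" where
  "physical_policy n a b c d \<longleftrightarrow>
     (\<forall>k\<in>{1..n}. \<forall>F\<in>{1/4..1}.
        0 \<le> purif_prob c d k F \<and> purif_prob c d k F \<le> 1 \<and>
        0 \<le> purif_num a b k F \<and> purif_num a b k F \<le> 3/4 * purif_prob c d k F)"

definition gnb_system ::
  "nat \<Rightarrow> real \<Rightarrow> real \<Rightarrow> real \<Rightarrow> real \<Rightarrow> real \<Rightarrow>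
   (nat \<Rightarrow> real) \<Rightarrow> (nat \<Rightarrow> real) \<Rightarrow> (nat \<Rightarrow> real) \<Rightarrow> (nat \<Rightarrow> real) \<Rightarrow> bool" where
  "gnb_system n p_gen p_con q \<Gamma> F_new a b c d \<longleftrightarrow>
     1 \<le> n \<and> 0 < p_gen \<and> p_gen \<le> 1 \<and> 0 < p_con \<and> p_con \<le> 1 \<and> 0 \<le> q \<and> q \<le> 1 \<and>
     0 \<le> \<Gamma> \<and> 1/4 < F_new \<and> F_new \<le> 1 \<and> physical_policy n a b c d"

text \<open>Probability that at least one of the \<open>n\<close> generation attempts in a time step succeeds.\<close>

definition p_gen_star :: "nat \<Rightarrow> real \<Rightarrow> real" where
  "p_gen_star n p_gen = 1 - (1 - p_gen) ^ n"

definition policy_avg :: "nat \<Rightarrow> real \<Rightarrow> (nat \<Rightarrow> real) \<Rightarrow> real" where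
  "policy_avg n p_gen x =
     (\<Sum>k=1..n. x k * real (n choose k) * (1 - p_gen) ^ (n - k) * p_gen ^ k)"

text \<open>Expected number of time steps for which memory G stays occupied once it has been filled.\<close>

definition E_occ ::
  "nat \<Rightarrow> real \<Rightarrow> real \<Rightarrow> real \<Rightarrow> real \<Rightarrow> real \<Rightarrow>
   (nat \<Rightarrow> real) \<Rightarrow> (nat \<Rightarrow> real) \<Rightarrow> (nat \<Rightarrow> real) \<Rightarrow> (nat \<Rightarrow> real) \<Rightarrow> real" where
  "E_occ n p_gen p_con q \<Gamma> F_new a b c d =
     (let ps = p_gen_star n p_gen;
          P = p_con + q * ps * (1 - p_con);
          R = exp \<Gamma> - (1 - q * ps) * (1 - p_con);
          A = q * (1 - p_con) * policy_avg n p_gen a / R;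
          C = q * (1 - p_con) * policy_avg n p_gen c / R;
          B = q * (1 - p_con) * policy_avg n p_gen b / P;
          D = q * (1 - p_con) * policy_avg n p_gen d / P
      in (1 - A + C * (F_new - 1/4)) / (((1 - A) * (1 - D) - B * C) * P))"

text \<open>
  The availability is the almost sure long-run fraction of consumption requests that find a link
  in memory G. It is a deterministic function of the parameters, and that function is taken as the
  definition: by renewal, each cycle consists of an empty phase of mean length
  \<open>1 / p_gen_star n p_gen\<close> and an occupied phase of mean length \<open>E_occ\<close>.
  For a \<open>gnb_system\<close> no division by zero occurs here or in \<open>E_occ\<close>.
\<close>

definition availability ::
  "nat \<Rightarrow> real \<Rightarrow> real \<Rightarrow> real \<Rightarrow> real \<Rightarrow> real \<Rightarrow>
   (nat \<Rightarrow> real) \<Rightarrow> (nat \<Rightarrow> real) \<Rightarrow> (nat \<Rightarrow> real) \<Rightarrow> (nat \<Rightarrow> real) \<Rightarrow> real" where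
  "availability n p_gen p_con q \<Gamma> F_new a b c d =
     E_occ n p_gen p_con q \<Gamma> F_new a b c d /
       (1 / p_gen_star n p_gen + E_occ n p_gen p_con q \<Gamma> F_new a b c d)"

end

theory Submission
  imports Defs
begin

text \<open>
  Averaging the policy over the number of generated links leaves four numbers. In units where
  \<open>F - 1/4\<close> ranges over \<open>[0, 1]\<close>, so that \<open>b\<close> is rescaled by \<open>4/3\<close> and \<open>c\<close> by \<open>3/4\<close>, physicality at
  the two endpoints says \<open>0 \<le> b \<le> d \<le> p*\<close> and \<open>0 \<le> a + b \<le> c + d \<le> p*\<close>, and the mean occupation
  time is \<open>N / M\<close> with \<open>N = R - s a + s c f\<close> and \<open>M = (R - s a)(P - s d) - s\<^sup>2 b c\<close>, where
  \<open>s = q (1 - p_con)\<close>, \<open>P = p_con + s p*\<close> and \<open>R = \<gamma> + P\<close>. The upper bound is \<open>p_con N \<le> M\<close>. For the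
  lower bound, \<open>N \<ge> \<gamma> + p_con\<close> and \<open>M \<le> R P\<close>, and \<open>R P\<close> is largest at \<open>q = 1\<close>,
  where it still falls short of the stated denominator less \<open>p* (\<gamma> + p_con)\<close> by
  \<open>(1 - p_con) p* (1 + (1 - p_con) p*)\<close>.
\<close>

lemma policy_avg_linear:
  "policy_avg n p (\<lambda>k. u * x k + v * y k) = u * policy_avg n p x + v * policy_avg n p y"
  unfolding policy_avg_def
  by (simp add: sum_distrib_left sum.distrib[symmetric] algebra_simps)

lemma policy_avg_mono:
  assumes "0 \<le> p" "p \<le> 1" "\<And>k. k \<in> {1..n} \<Longrightarrow> x k \<le> y k"
  shows "policy_avg n p x \<le> policy_avg n p y"
  unfolding policy_avg_def using assms
  by (intro sum_mono mult_right_mono) auto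

lemma policy_avg_one: "policy_avg n p (\<lambda>_. 1) = p_gen_star n p"
proof -
  have "(\<Sum>k\<le>n. real (n choose k) * p ^ k * (1 - p) ^ (n - k)) = 1"
    using binomial_ring[of p "1 - p" n] by simp
  \<comment> \<open>The average starts at \<open>k = 1\<close>; the missing term
    \<open>(1 - p) ^ n\<close> separates the total binomial mass 1 from p*.\<close>
  moreover have "{..n} = insert 0 {1..n}" by auto
  ultimately show ?thesis
    by (simp add: policy_avg_def p_gen_star_def mult.commute mult.left_commute)
qed

lemma p_gen_star_pos:
  assumes "1 \<le> n" "0 < p" "p \<le> 1"
  shows "0 < p_gen_star n p"
  using assms power_strict_mono[of "1 - p" 1 n] by (simp add: p_gen_star_def)

text \<open>Averaging is linear and monotone and sends 1 to p*, so inequalities valid for each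
  \<open>k\<close> survive it. The first three come from \<open>F = 1/4\<close>, the last three from
  \<open>F = 1\<close>.\<close>

lemma policy_avg_physical:
  fixes n p a b c d
  assumes "0 \<le> p" "p \<le> 1" "physical_policy n a b c d"
  defines "\<alpha> \<equiv> policy_avg n p a" and "\<beta> \<equiv> 4/3 * policy_avg n p b"
    and "\<chi> \<equiv> 3/4 * policy_avg n p c" and "\<delta> \<equiv> policy_avg n p d"
  shows "0 \<le> \<beta>" "\<beta> \<le> \<delta>" "\<delta> \<le> p_gen_star n p"
    and "0 \<le> \<alpha> + \<beta>" "\<alpha> + \<beta> \<le> \<chi> + \<delta>" "\<chi> + \<delta> \<le> p_gen_star n p"
proof -
  \<comment> \<open>With two terms on each side, every bound is a single instance; a zero
    coefficient discards its term, whatever sequence it multiplies.\<close>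
  have avg_le: "u1 * policy_avg n p x1 + v1 * policy_avg n p y1
                \<le> u2 * policy_avg n p x2 + v2 * policy_avg n p y2"
    if "\<And>k. k \<in> {1..n} \<Longrightarrow> u1 * x1 k + v1 * y1 k \<le> u2 * x2 k + v2 * y2 k"
    for u1 v1 u2 v2 x1 y1 x2 y2
    using policy_avg_mono[OF assms(1,2) that] by (simp add: policy_avg_linear)
  have bot: "d k \<le> 1" "0 \<le> b k" "b k \<le> 3/4 * d k" if "k \<in> {1..n}" for k
    using assms(3) that unfolding physical_policy_def purif_prob_def purif_num_def
    by (auto dest!: bspec[of _ _ k] bspec[of _ _ "1/4"])
  have top: "3/4 * c k + d k \<le> 1" "0 \<le> 3/4 * a k + b k"
      "3/4 * a k + b k \<le> 3/4 * (3/4 * c k + d k)" if "k \<in> {1..n}" for k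
    using assms(3) that unfolding physical_policy_def purif_prob_def purif_num_def
    by (auto dest!: bspec[of _ _ k] bspec[of _ _ "1::real"])
  show "0 \<le> \<beta>" "\<beta> \<le> \<delta>" "\<delta> \<le> p_gen_star n p"
    using avg_le[of 0 b 0 b 1 b 0 b] avg_le[of 1 b 0 b "3/4" d 0 d]
      avg_le[of 1 d 0 d 1 "\<lambda>_. 1" 0 d] bot
    by (auto simp: \<beta>_def \<delta>_def policy_avg_one)
  show "0 \<le> \<alpha> + \<beta>" "\<chi> + \<delta> \<le> p_gen_star n p"
    using avg_le[of 0 a 0 b "3/4" a 1 b] avg_le[of "3/4" c 1 d 1 "\<lambda>_. 1" 0 d] top
    by (auto simp: \<alpha>_def \<beta>_def \<chi>_def \<delta>_def policy_avg_one)
  show "\<alpha> + \<beta> \<le> \<chi> + \<delta>"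
    using avg_le[of "3/4" a 1 b "9/16" c "3/4" d] top
    by (auto simp: \<alpha>_def \<beta>_def \<chi>_def \<delta>_def algebra_simps)
qed

lemma occupation_bounds:
  fixes \<alpha> \<beta> \<chi> \<delta> ps pc s \<gamma> f :: real
  assumes avg: "0 \<le> \<beta>" "\<beta> \<le> \<delta>" "\<delta> \<le> ps" "0 \<le> \<alpha> + \<beta>" "\<alpha> + \<beta> \<le> \<chi> + \<delta>" "\<chi> + \<delta> \<le> ps"
    and pars: "0 < pc" "0 \<le> s" "0 \<le> \<gamma>" "0 \<le> f" "f \<le> 1"
  defines "P \<equiv> pc + s * ps" and "R \<equiv> \<gamma> + pc + s * ps"
  defines "N \<equiv> R - s * \<alpha> + s * \<chi> * f" and "M \<equiv> (R - s * \<alpha>) * (P - s * \<delta>) - s\<^sup>2 * (\<beta> * \<chi>)"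
  shows "\<gamma> + pc \<le> N" "pc * N \<le> M" "M \<le> R * P"
proof -
  have R_ge: "\<gamma> + pc + s * \<beta> \<le> R - s * \<alpha>"
    using mult_left_mono[of "\<alpha> + \<beta>" ps s] avg pars by (simp add: R_def algebra_simps)
  have P_ge: "pc \<le> P - s * \<delta>" "pc + s * \<chi> \<le> P - s * \<delta>"
    using mult_left_mono[of \<delta> ps s] mult_left_mono[of "\<chi> + \<delta>" ps s] avg pars
    by (simp_all add: P_def algebra_simps)
  have nn: "0 \<le> s * \<beta>" "0 \<le> s * \<delta>" using avg pars by auto
  \<comment> \<open>\<open>N\<close> is affine in \<open>f\<close>, so its extremes lie at
    \<open>f = 0\<close> and \<open>f = 1\<close>; the sign of \<chi> decides which is
    which.\<close>
  have f_le: "s * \<chi> * f \<le> max 0 (s * \<chi>)" "min 0 (s * \<chi>) \<le> s * \<chi> * f"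
  proof -
    show "s * \<chi> * f \<le> max 0 (s * \<chi>)"
      using pars mult_left_le[of f "s * \<chi>"] mult_nonpos_nonneg[of "s * \<chi>" f]
      by (cases "0 \<le> s * \<chi>") auto
    show "min 0 (s * \<chi>) \<le> s * \<chi> * f"
      using pars mult_left_le[of f "- (s * \<chi>)"] by (cases "0 \<le> s * \<chi>") auto
  qed
  have "s * (\<alpha> - \<chi>) \<le> s * ps"
    using avg pars by (intro mult_left_mono) auto
  then show "\<gamma> + pc \<le> N"
    using f_le(2) R_ge nn unfolding N_def by (auto simp: R_def algebra_simps min_def split: if_splits)
  have M_eq: "M = (R - s * \<alpha>) * (P - s * \<delta>) - (s * \<beta>) * (s * \<chi>)"
    by (simp add: M_def power2_eq_square)
  \<comment> \<open>The left side is \<open>pc\<close> times the largest value of \<open>N\<close>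
    over \<open>f\<close>. For \<chi> nonnegative, the surplus \<open>s * \<chi>\<close> in the
    second bound of \<open>P_ge\<close> pays for the subtracted product, since
    \<open>R - s * \<alpha>\<close> exceeds \<open>s * \<beta>\<close> by at least
    \<open>pc\<close>.\<close>
  have "pc * (R - s * \<alpha>) + pc * max 0 (s * \<chi>) \<le> M"
  proof (cases "0 \<le> s * \<chi>")
    case True
    have "(s * \<beta> + pc) * (s * \<chi>) \<le> (R - s * \<alpha>) * (s * \<chi>)"
      using R_ge pars True by (intro mult_right_mono) auto
    moreover have "(R - s * \<alpha>) * (pc + s * \<chi>) \<le> (R - s * \<alpha>) * (P - s * \<delta>)"
      using P_ge R_ge nn pars by (intro mult_left_mono) auto
    ultimately show ?thesis using True by (simp add: M_eq algebra_simps)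
  next
    case False
    have "(R - s * \<alpha>) * pc \<le> (R - s * \<alpha>) * (P - s * \<delta>)"
      using P_ge R_ge nn pars by (intro mult_left_mono) auto
    moreover have "(s * \<beta>) * (s * \<chi>) \<le> 0"
      using False nn mult_nonneg_nonpos[of "s * \<beta>" "s * \<chi>"] by simp
    ultimately show ?thesis using False by (simp add: M_eq mult.commute)
  qed
  then show "pc * N \<le> M"
    using mult_left_mono[OF f_le(1), of pc] pars unfolding N_def distrib_left by linarith
  \<comment> \<open>Replacing \<alpha> by \<open>- \<beta>\<close> and \<chi> by
    \<open>- \<delta>\<close> only increases \<open>M\<close>. The quadratic terms in
    \<open>s * \<beta>\<close> and \<open>s * \<delta>\<close> then cancel, leaving
    \<open>R * P + s * \<beta> * P - s * \<delta> * R\<close>, where \<beta> \<le> \<delta> and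
    \<open>P\<close> \<le> \<open>R\<close>.\<close>
  have "(R - s * \<alpha>) * (P - s * \<delta>) \<le> (R + s * \<beta>) * (P - s * \<delta>)"
    using mult_left_mono[of 0 "\<alpha> + \<beta>" s] avg pars P_ge
    by (intro mult_right_mono) (auto simp: algebra_simps)
  moreover have "(s * \<beta>) * (- s * \<delta>) \<le> (s * \<beta>) * (s * \<chi>)"
    using mult_left_mono[of "- \<delta>" \<chi> s] avg pars nn by (intro mult_left_mono) auto
  moreover have "(s * \<beta>) * P \<le> (s * \<delta>) * R"
    using avg pars nn by (intro mult_mono) (auto simp: P_def R_def mult_left_mono)
  ultimately show "M \<le> R * P"
    by (simp add: M_eq algebra_simps)
qed

text \<open>Multiplying numerator and denominator by \<open>R\<close> clears the inner fractions,
  and the rescalings 4/3 and 3/4 cancel in \<open>\<beta> * \<chi>\<close> and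
  \<open>\<chi> * f\<close>.\<close>

lemma E_occ_eq:
  fixes n p_gen p_con q \<Gamma> F_new a b c d
  defines "s \<equiv> q * (1 - p_con)"
    and "\<alpha> \<equiv> policy_avg n p_gen a" and "\<beta> \<equiv> 4/3 * policy_avg n p_gen b"
    and "\<chi> \<equiv> 3/4 * policy_avg n p_gen c" and "\<delta> \<equiv> policy_avg n p_gen d"
    and "f \<equiv> 4/3 * (F_new - 1/4)"
  defines "P \<equiv> p_con + s * p_gen_star n p_gen"
    and "R \<equiv> exp \<Gamma> - 1 + p_con + s * p_gen_star n p_gen"
  assumes "0 < P" "0 < R"
  shows "E_occ n p_gen p_con q \<Gamma> F_new a b c d =
    (R - s * \<alpha> + s * \<chi> * f) / ((R - s * \<alpha>) * (P - s * \<delta>) - s\<^sup>2 * (\<beta> * \<chi>))"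
proof -
  have P: "p_con + q * p_gen_star n p_gen * (1 - p_con) = P"
    and R: "exp \<Gamma> - (1 - q * p_gen_star n p_gen) * (1 - p_con) = R"
    by (simp_all add: P_def R_def s_def algebra_simps)
  have "E_occ n p_gen p_con q \<Gamma> F_new a b c d =
      (1 - s * \<alpha> / R + s * policy_avg n p_gen c / R * (F_new - 1/4)) /
      (((1 - s * \<alpha> / R) * (1 - s * \<delta> / P)
        - s * policy_avg n p_gen b / P * (s * policy_avg n p_gen c / R)) * P)"
    unfolding E_occ_def Let_def P R by (simp add: s_def \<alpha>_def \<delta>_def)
  also have "1 - s * \<alpha> / R + s * policy_avg n p_gen c / R * (F_new - 1/4)
      = (R - s * \<alpha> + s * \<chi> * f) / R"
    using assms(10) by (simp add: \<chi>_def f_def field_simps)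
  also have "((1 - s * \<alpha> / R) * (1 - s * \<delta> / P)
        - s * policy_avg n p_gen b / P * (s * policy_avg n p_gen c / R)) * P
      = ((R - s * \<alpha>) * (P - s * \<delta>) - s\<^sup>2 * (\<beta> * \<chi>)) / R"
    using assms(9,10) by (simp add: \<beta>_def \<chi>_def field_simps power2_eq_square)
  finally show ?thesis using assms(10) by simp
qed

theorem corollary1:
  fixes n :: nat
    and p_gen p_con q \<Gamma> F_new :: real
    and a b c d :: "nat \<Rightarrow> real"
  assumes "gnb_system n p_gen p_con q \<Gamma> F_new a b c d"
  shows "let ps = p_gen_star n p_gen;
             \<gamma> = exp \<Gamma> - 1;
             \<xi> = \<gamma> * p_con + p_con\<^sup>2;
             \<xi>' = 1 + 2 * \<gamma> + (2 - \<gamma>) * p_con - 2 * p_con\<^sup>2;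
             \<xi>'' = 2 * (1 - p_con)\<^sup>2;
             A = availability n p_gen p_con q \<Gamma> F_new a b c d
         in ps * (\<gamma> + p_con) / (\<xi> + \<xi>' * ps + \<xi>'' * ps\<^sup>2) \<le> A
            \<and> A \<le> ps / (ps + p_con)
            \<and> (q = 0 \<longrightarrow> A = ps / (ps + p_con))"
proof -
  define ps where "ps = p_gen_star n p_gen"
  define \<gamma> where "\<gamma> = exp \<Gamma> - 1"
  define s where "s = q * (1 - p_con)"
  define P where "P = p_con + s * ps"
  define R where "R = \<gamma> + p_con + s * ps"
  define E where "E = E_occ n p_gen p_con q \<Gamma> F_new a b c d"
  \<comment> \<open>The first product is \<open>R * P\<close> at \<open>q = 1\<close>; the second is
    the slack that makes \<open>K + ps * (\<gamma> + p_con)\<close> the stated denominator.\<close>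
  define K where "K = (\<gamma> + p_con + (1 - p_con) * ps) * (p_con + (1 - p_con) * ps)
    + (1 - p_con) * ps * (1 + (1 - p_con) * ps)"
  have par: "1 \<le> n" "0 < p_gen" "p_gen \<le> 1" "0 < p_con" "p_con \<le> 1" "0 \<le> q" "q \<le> 1"
      "0 \<le> \<Gamma>" "1/4 < F_new" "F_new \<le> 1" and phys: "physical_policy n a b c d"
    using assms by (auto simp: gnb_system_def)
  have ps: "0 < ps" using p_gen_star_pos par by (simp add: ps_def)
  have \<gamma>: "0 \<le> \<gamma>" using par by (simp add: \<gamma>_def)
  have s: "0 \<le> s" "s \<le> 1 - p_con"
    using par mult_right_mono[of q 1 "1 - p_con"] by (auto simp: s_def)
  have PR: "0 < P" "0 < R" using ps \<gamma> s par by (auto simp: P_def R_def add_pos_nonneg)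
  obtain N M where E: "E = N / M" and NM: "\<gamma> + p_con \<le> N" "p_con * N \<le> M" "M \<le> R * P"
  proof
    let ?\<alpha> = "policy_avg n p_gen a" and ?\<beta> = "4/3 * policy_avg n p_gen b"
      and ?\<chi> = "3/4 * policy_avg n p_gen c" and ?\<delta> = "policy_avg n p_gen d"
      and ?f = "4/3 * (F_new - 1/4)"
    show "E = (R - s * ?\<alpha> + s * ?\<chi> * ?f) / ((R - s * ?\<alpha>) * (P - s * ?\<delta>) - s\<^sup>2 * (?\<beta> * ?\<chi>))"
      using E_occ_eq[of p_con q n p_gen \<Gamma>] PR
      unfolding E_def P_def R_def s_def ps_def \<gamma>_def by blast
    note avg = policy_avg_physical[OF less_imp_le[OF par(2)] par(3) phys, folded ps_def]
    have f: "0 \<le> ?f" "?f \<le> 1" using par by auto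
    note bounds = occupation_bounds[OF avg par(4) s(1) \<gamma> f, folded P_def R_def]
    show "\<gamma> + p_con \<le> R - s * ?\<alpha> + s * ?\<chi> * ?f"
      "p_con * (R - s * ?\<alpha> + s * ?\<chi> * ?f) \<le> (R - s * ?\<alpha>) * (P - s * ?\<delta>) - s\<^sup>2 * (?\<beta> * ?\<chi>)"
      "(R - s * ?\<alpha>) * (P - s * ?\<delta>) - s\<^sup>2 * (?\<beta> * ?\<chi>) \<le> R * P"
      using bounds by blast+
  qed
  have N: "0 < N" using NM \<gamma> par by linarith
  moreover have "0 < p_con * N" using N par by simp
  ultimately have M: "0 < M" using NM by linarith
  \<comment> \<open>This is increasing in \<open>N / M\<close>, which lies between
    \<open>(\<gamma> + p_con) / K\<close> and \<open>1 / p_con\<close>.\<close>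
  have A: "availability n p_gen p_con q \<Gamma> F_new a b c d = ps * N / (M + ps * N)"
    unfolding availability_def E_def[symmetric] ps_def[symmetric] E
    using N M ps by (simp add: field_simps)
  have "s * ps \<le> (1 - p_con) * ps" using s ps by (intro mult_right_mono) auto
  then have "R * P \<le> (\<gamma> + p_con + (1 - p_con) * ps) * (p_con + (1 - p_con) * ps)"
    using PR par \<gamma> ps by (intro mult_mono) (auto simp: R_def P_def)
  also have "\<dots> \<le> K" using par ps by (simp add: K_def)
  finally have MK: "M \<le> K" using NM by simp
  have "ps * (\<gamma> + p_con) / (K + ps * (\<gamma> + p_con)) \<le> ps * N / (M + ps * N)"
  proof -
    have "(\<gamma> + p_con) * M \<le> N * K"
      using NM MK N M by (intro mult_mono) auto
    from mult_left_mono[OF this, of ps] have "ps * ((\<gamma> + p_con) * M) \<le> ps * (N * K)"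
      using ps by simp
    moreover have "0 < K + ps * (\<gamma> + p_con)" "0 < M + ps * N"
      using MK M ps par \<gamma> N by (auto intro!: add_pos_pos)
    ultimately show ?thesis
      by (simp add: divide_le_eq le_divide_eq algebra_simps)
  qed
  moreover have "K + ps * (\<gamma> + p_con) = \<gamma> * p_con + p_con\<^sup>2
      + (1 + 2 * \<gamma> + (2 - \<gamma>) * p_con - 2 * p_con\<^sup>2) * ps + 2 * (1 - p_con)\<^sup>2 * ps\<^sup>2"
    by (simp add: K_def power2_eq_square algebra_simps)
  moreover have "ps * N / (M + ps * N) \<le> ps / (ps + p_con)"
  proof -
    have "ps * N / (M + ps * N) \<le> ps * N / (p_con * N + ps * N)"
      using NM N M ps par by (intro divide_left_mono) (auto intro!: add_pos_pos mult_pos_pos)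
    also have "\<dots> = ps / (ps + p_con)"
      using N mult_divide_mult_cancel_right[of N ps "ps + p_con"] by (simp add: distrib_right add.commute)
    finally show ?thesis .
  qed
  \<comment> \<open>All policy terms carry a factor \<open>q\<close>, so \<open>E_occ\<close>
    reduces to \<open>1 / p_con\<close>.\<close>
  moreover have "availability n p_gen p_con q \<Gamma> F_new a b c d = ps / (ps + p_con)" if "q = 0"
    using that ps par by (simp add: availability_def E_occ_def ps_def[symmetric] field_simps)
  ultimately show ?thesis
    unfolding Let_def A ps_def[symmetric] \<gamma>_def[symmetric] by simp
qed

end
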